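(* In the affine Weyl group $W=\langle s_0,s_1,\dots,s_7\rangle$ of type $E_7^{(1)}$, put $$T_1=(s_{04567345623451234})^2,\qquad T_3=(s_{26756456734567104567345604534})^2,\qquad \psi=s_{403423}.$$ Then $$T_3=\psi^{-1}T_1\psi.$$
   Context: Notation: $s_{i_0i_1\cdots i_n}:=s_{i_0}s_{i_1}\cdots s_{i_n}$ (each index is a single digit in $\{0,\dots,7\}$). $W$ is the Coxeter group with generators $s_0,\dots,s_7$ and relations $s_i^2=1$; $s_is_js_i=s_js_is_j$ if $i,j$ are joined by an edge of the Dynkin diagram; $s_is_j=s_js_i$ otherwise. The Dynkin diagram of type $E_7^{(1)}$ is the chain $1-2-3-4-5-6-7$ with an additional node $0$ joined to node $4$. *)

theory Defs
  imports "HOL-Algebra.Group"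
begin

text \<open>
  The group presented by generators \<open>S\<close> and relations \<open>R\<close>: words in signed letters, where
  \<open>(a, True)\<close> stands for the generator \<open>a\<close> and \<open>(a, False)\<close> for its formal inverse, modulo the
  least congruence containing free cancellation and the pairs in \<open>R\<close>.
\<close>

type_synonym 'g word = "('g \<times> bool) list"

definition words :: "'g set \<Rightarrow> 'g word set" where
  "words S = lists (S \<times> UNIV)"

inductive_set pres_cong :: "'g set \<Rightarrow> ('g word \<times> 'g word) set \<Rightarrow> ('g word \<times> 'g word) set"
  for S :: "'g set" and R :: "('g word \<times> 'g word) set" where
  refl: "w \<in> words S \<Longrightarrow> (w, w) \<in> pres_cong S R"
| sym: "(u, v) \<in> pres_cong S R \<Longrightarrow> (v, u) \<in> pres_cong S R"
| trans: "(u, v) \<in> pres_cong S R \<Longrightarrow> (v, w) \<in> pres_cong S R \<Longrightarrow> (u, w) \<in> pres_cong S R"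
| app: "(u, u') \<in> pres_cong S R \<Longrightarrow> (v, v') \<in> pres_cong S R \<Longrightarrow> (u @ v, u' @ v') \<in> pres_cong S R"
| cancel: "a \<in> S \<Longrightarrow> ([(a, b), (a, \<not> b)], []) \<in> pres_cong S R"
| rel: "(u, v) \<in> R \<Longrightarrow> u \<in> words S \<Longrightarrow> v \<in> words S \<Longrightarrow> (u, v) \<in> pres_cong S R"

definition pres_class :: "'g set \<Rightarrow> ('g word \<times> 'g word) set \<Rightarrow> 'g word \<Rightarrow> 'g word set" where
  "pres_class S R w = pres_cong S R `` {w}"

definition presented_group :: "'g set \<Rightarrow> ('g word \<times> 'g word) set \<Rightarrow> 'g word set monoid" where
  "presented_group S R =
     \<lparr>carrier = words S // pres_cong S R,
      mult = (\<lambda>X Y. \<Union>x\<in>X. \<Union>y\<in>Y. pres_class S R (x @ y)),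
      one = pres_class S R []\<rparr>"

text \<open>
  The simply laced Coxeter group of a graph with nodes \<open>S\<close>, where nodes \<open>i\<close>, \<open>j\<close> are joined iff
  \<open>{i, j} \<in> E\<close>.
\<close>

definition coxeter_relations :: "'g set \<Rightarrow> 'g set set \<Rightarrow> ('g word \<times> 'g word) set" where
  "coxeter_relations S E =
     {([(i, True), (i, True)], []) | i. i \<in> S} \<union>
     {([(i, True), (j, True), (i, True)], [(j, True), (i, True), (j, True)]) | i j.
        i \<in> S \<and> j \<in> S \<and> i \<noteq> j \<and> {i, j} \<in> E} \<union>
     {([(i, True), (j, True)], [(j, True), (i, True)]) | i j.
        i \<in> S \<and> j \<in> S \<and> i \<noteq> j \<and> {i, j} \<notin> E}"

definition E7_nodes :: "nat set" where
  "E7_nodes = {0..7}"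

definition E7_edges :: "nat set set" where
  "E7_edges = {{1,2}, {2,3}, {3,4}, {4,5}, {5,6}, {6,7}, {0,4}}"

definition W :: "nat word set monoid" where
  "W = presented_group E7_nodes (coxeter_relations E7_nodes E7_edges)"

definition s :: "nat \<Rightarrow> nat word set" where
  "s i = pres_class E7_nodes (coxeter_relations E7_nodes E7_edges) [(i, True)]"

definition s_word :: "nat list \<Rightarrow> nat word set" where
  "s_word is = foldr (\<lambda>i g. s i \<otimes>\<^bsub>W\<^esub> g) is \<one>\<^bsub>W\<^esub>"

subsection \<open>The presented group is a group and satisfies its relations\<close>

lemma words_simps:
  "[] \<in> words S" "x # w \<in> words S \<longleftrightarrow> fst x \<in> S \<and> w \<in> words S"
  "u @ v \<in> words S \<longleftrightarrow> u \<in> words S \<and> v \<in> words S"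
  by (cases x; auto simp: words_def)+

lemma pres_cong_words:
  "(u, v) \<in> pres_cong S R \<Longrightarrow> u \<in> words S \<and> v \<in> words S"
  by (induction rule: pres_cong.induct) (auto simp: words_def)

lemma equiv_pres_cong: "equiv (words S) (pres_cong S R)"
proof (rule equivI)
  show "pres_cong S R \<subseteq> words S \<times> words S" by (auto dest: pres_cong_words)
  show "refl_on (words S) (pres_cong S R)" by (rule refl_onI, rule pres_cong.refl)
  show "sym (pres_cong S R)" by (rule symI, rule pres_cong.sym)
  show "trans (pres_cong S R)" by (rule transI, rule pres_cong.trans)
qed

lemma pres_class_eq_iff:
  "u \<in> words S \<Longrightarrow> v \<in> words S \<Longrightarrow>
   pres_class S R u = pres_class S R v \<longleftrightarrow> (u, v) \<in> pres_cong S R"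
  unfolding pres_class_def by (rule eq_equiv_class_iff[OF equiv_pres_cong])

lemma pres_class_mult:
  assumes "u \<in> words S" "v \<in> words S"
  shows "pres_class S R u \<otimes>\<^bsub>presented_group S R\<^esub> pres_class S R v = pres_class S R (u @ v)"
proof -
  have eq: "pres_class S R (x @ y) = pres_class S R (u @ v)"
    if "x \<in> pres_class S R u" "y \<in> pres_class S R v" for x y
  proof -
    have "(u @ v, x @ y) \<in> pres_cong S R"
      using that by (simp add: pres_class_def pres_cong.app)
    then show ?thesis
      unfolding pres_class_def by (rule equiv_class_eq[OF equiv_pres_cong, symmetric])
  qed
  have "u \<in> pres_class S R u" "v \<in> pres_class S R v"
    using assms by (simp_all add: pres_class_def pres_cong.refl)
  then have "(\<Union>x\<in>pres_class S R u. \<Union>y\<in>pres_class S R v. pres_class S R (u @ v)) =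
      pres_class S R (u @ v)"
    by blast
  then show ?thesis
    by (simp add: presented_group_def eq cong: SUP_cong)
qed

lemma carrier_presented_group: "carrier (presented_group S R) = pres_class S R ` words S"
  by (auto simp: presented_group_def pres_class_def quotient_def)

lemma one_presented_group: "\<one>\<^bsub>presented_group S R\<^esub> = pres_class S R []"
  by (simp add: presented_group_def)

lemma pres_cong_inverse:
  "w \<in> words S \<Longrightarrow> (rev (map (\<lambda>(a, b). (a, \<not> b)) w) @ w, []) \<in> pres_cong S R"
proof (induction w)
  case Nil
  then show ?case by (auto simp: words_def intro: pres_cong.refl)
next
  case (Cons x w)
  obtain a b where x: "x = (a, b)" by (cases x)
  let ?r = "rev (map (\<lambda>(a, b). (a, \<not> b)) w)"
  have w: "a \<in> S" "w \<in> words S" using Cons.prems by (auto simp: x words_def)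
  then have r: "?r \<in> words S" by (auto simp: words_def)
  have "([(a, \<not> b), (a, b)], []) \<in> pres_cong S R"
    using pres_cong.cancel[OF w(1), of "\<not> b"] by simp
  then have "(?r @ [(a, \<not> b), (a, b)] @ w, ?r @ [] @ w) \<in> pres_cong S R"
    using r w by (intro pres_cong.app pres_cong.refl)
  then have "(?r @ [(a, \<not> b), (a, b)] @ w, []) \<in> pres_cong S R"
    using Cons.IH[OF w(2)] by (simp add: pres_cong.trans[of _ "?r @ w"])
  then show ?case by (simp add: x)
qed

lemma group_presented_group: "group (presented_group S R)"
proof (rule groupI)
  fix X assume "X \<in> carrier (presented_group S R)"
  then obtain w where w: "w \<in> words S" "X = pres_class S R w"
    by (auto simp: carrier_presented_group)
  let ?r = "rev (map (\<lambda>(a, b). (a, \<not> b)) w)"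
  have r: "?r \<in> words S" using w by (auto simp: words_def)
  have "?r @ w \<in> words S" "[] \<in> words S" using r w by (auto simp: words_def)
  then have "pres_class S R ?r \<otimes>\<^bsub>presented_group S R\<^esub> X = \<one>\<^bsub>presented_group S R\<^esub>"
    using pres_cong_inverse[OF w(1), of R] r w
    by (simp add: pres_class_mult one_presented_group pres_class_eq_iff)
  then show "\<exists>Y\<in>carrier (presented_group S R).
      Y \<otimes>\<^bsub>presented_group S R\<^esub> X = \<one>\<^bsub>presented_group S R\<^esub>"
    using r by (auto simp: carrier_presented_group)
qed (auto simp: carrier_presented_group one_presented_group pres_class_mult words_simps)

lemma group_W: "group W"
  by (simp add: W_def group_presented_group)

lemma s_carrier: "i \<in> E7_nodes \<Longrightarrow> s i \<in> carrier W"
  by (auto simp: W_def s_def carrier_presented_group words_def)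

lemma s_square:
  assumes "i \<in> E7_nodes"
  shows "s i \<otimes>\<^bsub>W\<^esub> s i = \<one>\<^bsub>W\<^esub>"
proof -
  have "([(i, True), (i, True)], []) \<in> pres_cong E7_nodes (coxeter_relations E7_nodes E7_edges)"
    using assms by (intro pres_cong.rel) (auto simp: words_simps coxeter_relations_def)
  then show ?thesis
    using assms by (simp add: W_def s_def one_presented_group pres_class_mult words_simps
        pres_class_eq_iff)
qed

lemma s_braid:
  assumes "i \<in> E7_nodes" "j \<in> E7_nodes" "i \<noteq> j" "{i, j} \<in> E7_edges"
  shows "s i \<otimes>\<^bsub>W\<^esub> s j \<otimes>\<^bsub>W\<^esub> s i = s j \<otimes>\<^bsub>W\<^esub> s i \<otimes>\<^bsub>W\<^esub> s j"
proof -
  have "([(i, True), (j, True), (i, True)], [(j, True), (i, True), (j, True)])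
      \<in> pres_cong E7_nodes (coxeter_relations E7_nodes E7_edges)"
    using assms by (intro pres_cong.rel) (auto simp: words_simps coxeter_relations_def)
  then show ?thesis
    using assms by (simp add: W_def s_def pres_class_mult words_simps pres_class_eq_iff)
qed

lemma s_commute:
  assumes "i \<in> E7_nodes" "j \<in> E7_nodes" "i \<noteq> j" "{i, j} \<notin> E7_edges"
  shows "s i \<otimes>\<^bsub>W\<^esub> s j = s j \<otimes>\<^bsub>W\<^esub> s i"
proof -
  have "([(i, True), (j, True)], [(j, True), (i, True)])
      \<in> pres_cong E7_nodes (coxeter_relations E7_nodes E7_edges)"
    using assms by (intro pres_cong.rel) (auto simp: words_simps coxeter_relations_def)
  then show ?thesis
    using assms by (simp add: W_def s_def pres_class_mult words_simps pres_class_eq_iff)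
qed

end

theory Submission
  imports Defs
begin

text \<open>
  Conjugating the square root of \<open>T1\<close> by \<open>psi\<close> gives the element \<open>x\<close> spelled by
  \<open>root_word\<close>. Conjugation by \<open>x\<close> permutes the generators \<open>s\<^sub>0, s\<^sub>4, s\<^sub>5, s\<^sub>6, s\<^sub>7\<close>
  through the reflection \<open>f = flip\<close> of the subdiagram \<open>0 - 4 - 5 - 6 - 7\<close>, and the square root
  of \<open>T3\<close> is \<open>u x v\<close> with \<open>u\<close>, \<open>v\<close> in the parabolic subgroup of that subdiagram. Hence
  \<open>T3 = u x v u x v = u f(v) f(u) v x\<^sup>2\<close>, and \<open>u f(v) f(u) v = 1\<close>. The remaining identities
  between words are certified by lists of positions at which a defining relation is applied.
\<close>

fun rewrite_head :: "nat list \<Rightarrow> nat list" where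
  "rewrite_head (i # j # w) =
     (if i = j then w
      else if {i, j} \<notin> E7_edges then j # i # w
      else if w \<noteq> [] \<and> hd w = i then j # i # j # tl w
      else i # j # w)"
| "rewrite_head w = w"

text \<open>A bare position suffices as a certificate step: the letters found there determine the
  relation to apply, and where none applies the word stays unchanged.\<close>

definition rewrite_at :: "nat \<Rightarrow> nat list \<Rightarrow> nat list" where
  "rewrite_at p w = take p w @ rewrite_head (drop p w)"

interpretation W: group W
  by (rule group_W)

lemma s_word_simps [simp]:
  "s_word [] = \<one>\<^bsub>W\<^esub>" "s_word (i # w) = s i \<otimes>\<^bsub>W\<^esub> s_word w"
  by (simp_all add: s_word_def)

lemma s_word_closed: "set w \<subseteq> E7_nodes \<Longrightarrow> s_word w \<in> carrier W"
  by (induction w) (auto simp: s_carrier)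

lemma s_word_append:
  "set u \<subseteq> E7_nodes \<Longrightarrow> set v \<subseteq> E7_nodes \<Longrightarrow> s_word (u @ v) = s_word u \<otimes>\<^bsub>W\<^esub> s_word v"
  by (induction u) (auto simp: s_carrier s_word_closed W.m_assoc)

lemma inv_s_word:
  "set w \<subseteq> E7_nodes \<Longrightarrow> inv\<^bsub>W\<^esub> s_word w = s_word (rev w)"
proof (induction w)
  case (Cons i w)
  then have "inv\<^bsub>W\<^esub> s i = s i"
    by (intro W.inv_equality) (auto simp: s_square s_carrier)
  with Cons show ?case
    by (simp add: s_word_append s_carrier s_word_closed W.inv_mult_group)
qed simp

lemma rewrite_head_nodes: "set w \<subseteq> E7_nodes \<Longrightarrow> set (rewrite_head w) \<subseteq> E7_nodes"
  by (cases w rule: rewrite_head.cases) (auto dest: list.set_sel)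

lemma s_word_rewrite_head:
  assumes "set w \<subseteq> E7_nodes"
  shows "s_word (rewrite_head w) = s_word w"
proof (cases w rule: rewrite_head.cases)
  case (1 i j v)
  then have ij: "i \<in> E7_nodes" "j \<in> E7_nodes" and v: "set v \<subseteq> E7_nodes"
    using assms by auto
  note carr = ij[THEN s_carrier] s_word_closed[OF v]
  consider (same) "i = j" | (commuting) "i \<noteq> j" "{i, j} \<notin> E7_edges"
    | (braid) v' where "i \<noteq> j" "{i, j} \<in> E7_edges" "v = i # v'"
    | (stuck) "i \<noteq> j" "{i, j} \<in> E7_edges" "v = [] \<or> hd v \<noteq> i"
    by (cases v) auto
  then show ?thesis
  proof cases
    case same
    then show ?thesis
      using 1 carr s_square[OF ij(1)] by (simp flip: W.m_assoc)
  next
    case commuting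
    then show ?thesis
      using 1 carr s_commute[OF ij] by (simp flip: W.m_assoc)
  next
    case (braid v')
    then have "s_word v' \<in> carrier W"
      using v by (intro s_word_closed) simp
    then show ?thesis
      using 1 carr braid s_braid[OF ij] by (simp flip: W.m_assoc)
  qed (auto simp: 1)
qed auto

lemma s_word_rewrite_at:
  assumes "set w \<subseteq> E7_nodes"
  shows "s_word (rewrite_at p w) = s_word w" "set (rewrite_at p w) \<subseteq> E7_nodes"
proof -
  have take: "set (take p w) \<subseteq> E7_nodes" and drop: "set (drop p w) \<subseteq> E7_nodes"
    using assms by (meson order_trans set_take_subset set_drop_subset)+
  have "s_word (rewrite_at p w) = s_word (take p w @ drop p w)"
    unfolding rewrite_at_def
    by (simp only: s_word_append take drop rewrite_head_nodes s_word_rewrite_head)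
  then show "s_word (rewrite_at p w) = s_word w"
    by simp
  show "set (rewrite_at p w) \<subseteq> E7_nodes"
    using take rewrite_head_nodes[OF drop] by (simp add: rewrite_at_def)
qed

text \<open>Every move preserves the group element, whatever positions are listed, so a certificate
  \<open>ps\<close> needs no justification beyond evaluating the fold.\<close>

lemma s_word_eqI:
  assumes "set u \<subseteq> E7_nodes" "fold rewrite_at ps u = v"
  shows "s_word u = s_word v"
proof -
  have "s_word (fold rewrite_at ps u) = s_word u"
    using assms(1) by (induction ps arbitrary: u) (simp_all add: s_word_rewrite_at)
  then show ?thesis
    using assms(2) by simp
qed

text \<open>Turns adjacency into a lookup of ordered pairs, which the simplifier decides on numerals
  while it replays a certificate.\<close>

lemma edge_iff:
  "{i, j} \<in> E7_edges \<longleftrightarrow> (i, j) \<in> {(1,2), (2,1), (2,3), (3,2), (3,4), (4,3), (4,5), (5,4),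
     (5,6), (6,5), (6,7), (7,6), (0,4), (4,0)}"
  by (auto simp: E7_edges_def doubleton_eq_iff)

definition root_word :: "nat list" where
  "root_word = [2,3,4,0,5,6,7,4,5,6,3,4,5,1,0,4,3]"

definition flip :: "nat \<Rightarrow> nat" where
  "flip = id(0 := 7, 7 := 0, 4 := 6, 6 := 4)"

abbreviation A5_nodes :: "nat set" where
  "A5_nodes \<equiv> {0, 4, 5, 6, 7}"

lemmas word_simps = rewrite_at_def edge_iff E7_nodes_def root_word_def

lemma root_word_nodes: "set root_word \<subseteq> E7_nodes"
  by (simp add: word_simps)

text \<open>The outer words spell the inverse of \<open>psi\<close> and \<open>psi\<close>, the
  middle one the square root of \<open>T1\<close>. Six cancellations bring 29 letters down to
  17.\<close>

lemma T1_root_conj: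
  "s_word ([3,2,4,3,0,4] @ [0,4,5,6,7,3,4,5,6,2,3,4,5,1,2,3,4] @ [4,0,3,4,2,3])
    = s_word root_word"
  by (rule s_word_eqI[where ps = "[4,2,0,6,4,5,6,7,8,2,3,4,5,6,7,8,9,10,16,15,16,14,15,16]"])
    (simp_all add: word_simps)

text \<open>Commutations alone suffice. The leading 2 commutes with every letter of the prefix
  \<open>[6,7,5,6,4,5,6,7]\<close>; further on, a 7, a 6 and a 5 move right to meet the final
  4.\<close>

lemma T3_root:
  "s_word [2,6,7,5,6,4,5,6,7,3,4,5,6,7,1,0,4,5,6,7,3,4,5,6,0,4,5,3,4]
    = s_word ([6,7,5,6,4,5,6,7] @ root_word @ [7,6,5,4])"
  by (rule s_word_eqI[where ps = "[0,1,2,3,4,5,6,7,14,13,12,11,15,16,17,19,18,20,19,21,20,23,22,24,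
        23,26,25,24]"])
    (simp_all add: word_simps)

text \<open>With y = u f(v), the word spells y f(y). In the symmetric group S_6 attached to the
  diagram A5, f is conjugation by the longest element w0, so the identity says that y w0 squares to
  1.\<close>

lemma A5_word_trivial:
  "s_word [6,7,5,6,4,5,6,7,0,4,5,6,4,0,5,4,6,5,4,0,7,6,5,4] = s_word []"
  by (rule s_word_eqI[where ps = "[3,4,2,1,2,3,6,4,0,3,1,7,8,4,5,6,5,6,7,10,8,3,4,7,5,11,8,9,10,9,
        7,8,7,6,5,4,3,2,1,0]"])
    (simp_all add: word_simps)

lemma s_root_word:
  assumes "i \<in> A5_nodes"
  shows "s i \<otimes>\<^bsub>W\<^esub> s_word root_word = s_word root_word \<otimes>\<^bsub>W\<^esub> s (flip i)"
proof -
  \<comment> \<open>The identities for \<open>i\<close> and \<open>flip i\<close> concern the same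
    conjugation applied to two different generators, so each gets its own certificate.\<close>
  have "s_word (0 # root_word) = s_word (root_word @ [7])"
    by (rule s_word_eqI[where ps = "[0,1,2,7,6,4,8,6,8,5,7,6,10,11,12,13,14,15,16]"])
      (simp_all add: word_simps)
  moreover have "s_word (7 # root_word) = s_word (root_word @ [0])"
    by (rule s_word_eqI[where ps = "[0,1,2,3,4,5,7,8,10,11,13,14,16]"])
      (simp_all add: word_simps)
  moreover have "s_word (4 # root_word) = s_word (root_word @ [6])"
    by (rule s_word_eqI[where ps = "[0,1,3,4,5,6,10,9,7,11,9,11,8,10,9,13,14,15,16]"])
      (simp_all add: word_simps)
  moreover have "s_word (6 # root_word) = s_word (root_word @ [4])"
    by (rule s_word_eqI[where ps = "[0,1,2,3,4,6,7,9,10,12,13,14,15]"])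
      (simp_all add: word_simps)
  moreover have "s_word (5 # root_word) = s_word (root_word @ [5])"
    by (rule s_word_eqI[where ps = "[0,1,4,2,7,6,4,6,7,8,9,10,14,13,11,15,13,3,5,6,12,15,14,13,16]"])
      (simp_all add: word_simps)
  ultimately have "s_word (i # root_word) = s_word (root_word @ [flip i])"
    using assms by (auto simp: flip_def)
  moreover have "flip i \<in> E7_nodes"
    using assms by (auto simp: flip_def E7_nodes_def)
  ultimately show ?thesis
    using root_word_nodes by (simp add: s_word_append s_carrier)
qed

lemma root_word_s_word:
  assumes "set w \<subseteq> A5_nodes"
  shows "s_word root_word \<otimes>\<^bsub>W\<^esub> s_word w = s_word (map flip w) \<otimes>\<^bsub>W\<^esub> s_word root_word"
  using assms
proof (induction w)
  case Nil
  then show ?case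
    by (simp add: s_word_closed root_word_nodes)
next
  case (Cons i w)
  have i: "flip i \<in> A5_nodes" "flip (flip i) = i" and A5: "A5_nodes \<subseteq> E7_nodes"
    using Cons.prems by (auto simp: flip_def E7_nodes_def)
  have w: "set w \<subseteq> E7_nodes" "set (map flip w) \<subseteq> E7_nodes"
    using Cons.prems by (auto simp: flip_def E7_nodes_def)
  have carr: "s i \<in> carrier W" "s (flip i) \<in> carrier W"
    using i(1) A5 Cons.prems by (auto intro!: s_carrier)
  note carr = carr w[THEN s_word_closed] root_word_nodes[THEN s_word_closed]
  \<comment> \<open>Since \<open>flip\<close> is an involution, \<open>s_root_word\<close> at
    \<open>flip i\<close> moves \<open>s i\<close> leftwards across
    \<open>root_word\<close>.\<close>
  have "s_word root_word \<otimes>\<^bsub>W\<^esub> s_word (i # w)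
      = s (flip i) \<otimes>\<^bsub>W\<^esub> (s_word root_word \<otimes>\<^bsub>W\<^esub> s_word w)"
    using s_root_word[OF i(1)] i(2) carr by (simp flip: W.m_assoc)
  then show ?case
    using Cons carr by (simp add: W.m_assoc)
qed

theorem proposition4p3p2:
  fixes T1 T3 psi :: "nat word set"
  assumes "T1 = s_word [0,4,5,6,7,3,4,5,6,2,3,4,5,1,2,3,4] [^]\<^bsub>W\<^esub> (2::nat)"
    and "T3 = s_word [2,6,7,5,6,4,5,6,7,3,4,5,6,7,1,0,4,5,6,7,3,4,5,6,0,4,5,3,4] [^]\<^bsub>W\<^esub> (2::nat)"
    and "psi = s_word [4,0,3,4,2,3]"
  shows "T3 = inv\<^bsub>W\<^esub> psi \<otimes>\<^bsub>W\<^esub> T1 \<otimes>\<^bsub>W\<^esub> psi"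
proof -
  define x where "x = s_word root_word"
  define a where "a = s_word [0,4,5,6,7,3,4,5,6,2,3,4,5,1,2,3,4]"
  define u v where "u = s_word [6,7,5,6,4,5,6,7]" and "v = s_word [7,6,5,4]"
  \<comment> \<open>The letterwise images of \<open>u\<close> and \<open>v\<close> under
    \<open>flip\<close>.\<close>
  define fu fv where "fu = s_word [4,0,5,4,6,5,4,0]" and "fv = s_word [0,4,5,6]"
  have carr: "x \<in> carrier W" "a \<in> carrier W" "u \<in> carrier W" "v \<in> carrier W"
      "fu \<in> carrier W" "fv \<in> carrier W" "psi \<in> carrier W"
    unfolding x_def a_def u_def v_def fu_def fv_def assms(3)
    by (rule s_word_closed; simp add: word_simps)+
  have comm: "x \<otimes>\<^bsub>W\<^esub> u = fu \<otimes>\<^bsub>W\<^esub> x" "x \<otimes>\<^bsub>W\<^esub> v = fv \<otimes>\<^bsub>W\<^esub> x" "x \<otimes>\<^bsub>W\<^esub> fv = v \<otimes>\<^bsub>W\<^esub> x"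
    unfolding x_def u_def v_def fu_def fv_def
    by (subst root_word_s_word; simp add: flip_def)+
  have trivial: "u \<otimes>\<^bsub>W\<^esub> fv \<otimes>\<^bsub>W\<^esub> fu \<otimes>\<^bsub>W\<^esub> v = \<one>\<^bsub>W\<^esub>"
    using A5_word_trivial unfolding u_def v_def fu_def fv_def
    by (simp add: s_carrier E7_nodes_def W.m_assoc)
  have square: "g [^]\<^bsub>W\<^esub> (2::nat) = g \<otimes>\<^bsub>W\<^esub> g" if "g \<in> carrier W" for g
    using that by (simp add: numeral_2_eq_2)
  have T1: "T1 = a \<otimes>\<^bsub>W\<^esub> a"
    unfolding assms(1) a_def[symmetric] by (rule square) (rule carr)
  have inv_psi: "inv\<^bsub>W\<^esub> psi = s_word [3,2,4,3,0,4]"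
    unfolding assms(3) by (subst inv_s_word) (simp_all add: E7_nodes_def)
  have x: "inv\<^bsub>W\<^esub> psi \<otimes>\<^bsub>W\<^esub> (a \<otimes>\<^bsub>W\<^esub> psi) = x"
    using T1_root_conj unfolding x_def a_def inv_psi unfolding assms(3)
    by (simp add: s_carrier E7_nodes_def W.m_assoc)
  \<comment> \<open>Between the two copies of the conjugate, \<open>psi\<close> cancels against its
    inverse, so the square of the conjugate is the conjugate of the square.\<close>
  have "psi \<otimes>\<^bsub>W\<^esub> (inv\<^bsub>W\<^esub> psi \<otimes>\<^bsub>W\<^esub> (a \<otimes>\<^bsub>W\<^esub> psi)) = a \<otimes>\<^bsub>W\<^esub> psi"
    using carr by (simp flip: W.m_assoc)
  then have "inv\<^bsub>W\<^esub> psi \<otimes>\<^bsub>W\<^esub> T1 \<otimes>\<^bsub>W\<^esub> psi = (inv\<^bsub>W\<^esub> psi \<otimes>\<^bsub>W\<^esub> (a \<otimes>\<^bsub>W\<^esub> psi)) \<otimes>\<^bsub>W\<^esub> (inv\<^bsub>W\<^esub> psi \<otimes>\<^bsub>W\<^esub> (a \<otimes>\<^bsub>W\<^esub> psi))"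
    using carr by (simp add: T1 W.m_assoc)
  then have conj: "inv\<^bsub>W\<^esub> psi \<otimes>\<^bsub>W\<^esub> T1 \<otimes>\<^bsub>W\<^esub> psi = x \<otimes>\<^bsub>W\<^esub> x"
    by (simp only: x)
  have T3_root': "s_word [2,6,7,5,6,4,5,6,7,3,4,5,6,7,1,0,4,5,6,7,3,4,5,6,0,4,5,3,4] = u \<otimes>\<^bsub>W\<^esub> x \<otimes>\<^bsub>W\<^esub> v"
    using carr root_word_nodes unfolding T3_root x_def u_def v_def
    by (simp add: s_word_append s_word_closed s_carrier E7_nodes_def W.m_assoc)
  have "T3 = (u \<otimes>\<^bsub>W\<^esub> x \<otimes>\<^bsub>W\<^esub> v) \<otimes>\<^bsub>W\<^esub> (u \<otimes>\<^bsub>W\<^esub> x \<otimes>\<^bsub>W\<^esub> v)"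
    unfolding assms(2) T3_root' using carr by (intro square) simp
  also have "\<dots> = u \<otimes>\<^bsub>W\<^esub> fv \<otimes>\<^bsub>W\<^esub> fu \<otimes>\<^bsub>W\<^esub> v \<otimes>\<^bsub>W\<^esub> (x \<otimes>\<^bsub>W\<^esub> x)"
  proof -
    \<comment> \<open>Both copies of \<open>x\<close> travel to the right end. The last
      \<open>v\<close> is crossed by both, hence flipped twice, and reappears as
      \<open>v\<close>.\<close>
    have "x \<otimes>\<^bsub>W\<^esub> v \<otimes>\<^bsub>W\<^esub> u \<otimes>\<^bsub>W\<^esub> x \<otimes>\<^bsub>W\<^esub> v = fv \<otimes>\<^bsub>W\<^esub> (x \<otimes>\<^bsub>W\<^esub> u) \<otimes>\<^bsub>W\<^esub> (x \<otimes>\<^bsub>W\<^esub> v)"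
      using carr by (simp add: comm(2) W.m_assoc)
    also have "\<dots> = fv \<otimes>\<^bsub>W\<^esub> fu \<otimes>\<^bsub>W\<^esub> (x \<otimes>\<^bsub>W\<^esub> fv) \<otimes>\<^bsub>W\<^esub> x"
      using carr by (simp add: comm(1,2) W.m_assoc)
    also have "\<dots> = fv \<otimes>\<^bsub>W\<^esub> fu \<otimes>\<^bsub>W\<^esub> v \<otimes>\<^bsub>W\<^esub> x \<otimes>\<^bsub>W\<^esub> x"
      using carr by (simp add: comm(3) W.m_assoc)
    finally show ?thesis
      using carr by (simp add: W.m_assoc)
  qed
  finally show ?thesis
    using carr by (simp add: trivial conj)
qed

end
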